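(* Let $\alpha: I\to E_1^3$ be a unit speed non-lightlike Frenet curve with Frenet frame $\{T,N,B\}$ and curvature $\kappa$, and let $\beta: I\to E_1^3$ be an $X$-direction curve of $\alpha$, where $X=uT+vN+wB$ is a unit non-lightlike vector field along $\alpha$. Then $\beta$ is a Mannheim-direction curve of $\alpha$ if and only if the following hold: (i) $u(s)=-\cosh\left(\int\kappa\,ds\right),\ v(s)=\sinh\left(\int\kappa\,ds\right),\ w(s)=0$, if $\alpha$ is a timelike curve (respectively, spacelike curve of type 1) and $X$ is timelike (respectively, spacelike); (ii) $u(s)=\sinh\left(\int\kappa\,ds\right),\ v(s)=-\cosh\left(\int\kappa\,ds\right),\ w(s)=0$, if $\alpha$ is a timelike curve (respectively, spacelike curve of type 1) and $X$ is spacelike (respectively, timelike); (iii) $u(s)=-\cos\left(\int\kappa\,ds\right),\ v(s)=\sin\left(\int\kappa\,ds\right),\ w(s)=0$, if $\alpha$ is a spacelike curve of type 2 and $X$ is spacelike.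
   Context: $E_1^3$ is $\mathbb{R}^3$ with the metric $\langle x,y\rangle=-x_1y_1+x_2y_2+x_3y_3$ and the Lorentz vector product $x\times y=(x_2y_3-x_3y_2,\ x_1y_3-x_3y_1,\ x_2y_1-x_1y_2)$. A vector $x$ is spacelike if $\langle x,x\rangle>0$ or $x=0$, timelike if $\langle x,x\rangle<0$, lightlike if $\langle x,x\rangle=0$ and $x\ne0$. A curve is timelike (spacelike) if all its velocity vectors are; non-lightlike means timelike or spacelike; unit speed means $|\langle\alpha',\alpha'\rangle|=1$. All functions are as differentiable as needed. A unit speed non-lightlike curve $\alpha(s)$ has Frenet frame $\{T,N,B\}$ (orthonormal, non-lightlike vectors, $T=\alpha'$), curvature $\kappa$ and torsion $\tau$ with $T'=\kappa N,\ N'=\varepsilon_B\kappa T+\tau B,\ B'=\varepsilon_T\tau N$, where $\varepsilon_Y=\langle Y,Y\rangle=\pm1$ and $\varepsilon_B=-\varepsilon_T\varepsilon_N$; the frame satisfies $B=\varepsilon_T\varepsilon_N T\times N$, $N=\varepsilon_B\varepsilon_T B\times T$, $T=\varepsilon_N\varepsilon_B N\times B$. It is a Frenet curve if $\kappa\neq0$. A spacelike curve is of type 1 if $N$ is timelike (and $T,B$ spacelike), of type 2 if $B$ is timelike (and $T,N$ spacelike). Let $X(s)=u(s)T(s)+v(s)N(s)+w(s)B(s)$ with $u,v,w$ differentiable and $\varepsilon_Tu^2+\varepsilon_Nv^2+\varepsilon_Bw^2=\pm1$ (constant sign). An $X$-direction curve of $\alpha$ is a curve $\beta$ whose tangent is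 $\overline T=X$ (an integral curve of $X$); $s$ is also arc-length for $\beta$. The Frenet frame, curvature and torsion of $\beta$ are $\{\overline T,\overline N,\overline B\},\overline\kappa,\overline\tau$, with $\overline\kappa\ne0$. $\beta$ is called a Mannheim-direction curve of $\alpha$ if $\beta$ is an $X$-direction curve of $\alpha$ and $\beta$ is a Mannheim curve of $\alpha$ with $\alpha$ a Mannheim partner curve of $\beta$, which means $\overline N=B$ along the curves. $\int\kappa\,ds$ denotes an indefinite integral (an antiderivative of $\kappa$, with a choice of additive constant).
   Formalization: In (i) and (ii) the formulas for u, v hold up to one common sign ±1 (replacing β by -β preserves the Mannheim condition but flips u, v, so the printed "only if" fails); the conditions are read as: one of the listed cases occurs with its formulas. *)

theory Defs
  imports "HOL-Analysis.Analysis"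
begin

text \<open>Minkowski 3-space: \<open>real^3\<close> with the first coordinate timelike.\<close>

definition lorentz :: "real^3 \<Rightarrow> real^3 \<Rightarrow> real" where
  "lorentz x y = - x$1 * y$1 + x$2 * y$2 + x$3 * y$3"

definition lorentz_cross :: "real^3 \<Rightarrow> real^3 \<Rightarrow> real^3" where
  "lorentz_cross x y =
     vector [x$2 * y$3 - x$3 * y$2, x$1 * y$3 - x$3 * y$1, x$2 * y$1 - x$1 * y$2]"

definition spacelike :: "real^3 \<Rightarrow> bool" where
  "spacelike x \<longleftrightarrow> lorentz x x > 0 \<or> x = 0"

definition timelike :: "real^3 \<Rightarrow> bool" where
  "timelike x \<longleftrightarrow> lorentz x x < 0"

abbreviation eps :: "real^3 \<Rightarrow> real" where
  "eps y \<equiv> lorentz y y"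

text \<open>Curves live on a nondegenerate interval \<open>I\<close>, possibly containing endpoints; all derivatives
  are taken within \<open>I\<close>.\<close>

definition velocity :: "real set \<Rightarrow> (real \<Rightarrow> real^3) \<Rightarrow> real \<Rightarrow> real^3" where
  "velocity I \<alpha> s = vector_derivative \<alpha> (at s within I)"

definition timelike_curve :: "real set \<Rightarrow> (real \<Rightarrow> real^3) \<Rightarrow> bool" where
  "timelike_curve I \<alpha> \<longleftrightarrow> (\<forall>s\<in>I. timelike (velocity I \<alpha> s))"

definition spacelike_curve :: "real set \<Rightarrow> (real \<Rightarrow> real^3) \<Rightarrow> bool" where
  "spacelike_curve I \<alpha> \<longleftrightarrow> (\<forall>s\<in>I. spacelike (velocity I \<alpha> s))"

definition unit_speed_curve :: "real set \<Rightarrow> (real \<Rightarrow> real^3) \<Rightarrow> bool" where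
  "unit_speed_curve I \<alpha> \<longleftrightarrow>
     \<alpha> differentiable_on I \<and> (\<forall>s\<in>I. \<bar>lorentz (velocity I \<alpha> s) (velocity I \<alpha> s)\<bar> = 1)"

text \<open>The Frenet apparatus is a relation, not a function of the curve: the curvature is not assumed
  positive, and \<open>(T, N, B, \<kappa>, \<tau>)\<close> and \<open>(T, -N, -B, -\<kappa>, \<tau>)\<close> are Frenet apparatuses of the same curve.
  The signs \<open>\<epsilon>\<^sub>T, \<epsilon>\<^sub>N, \<epsilon>\<^sub>B\<close> appear as \<open>eps (T s)\<close> etc.; they are constant on \<open>I\<close> by
  continuity. The relations \<open>\<epsilon>\<^sub>B = - \<epsilon>\<^sub>T \<epsilon>\<^sub>N\<close>, \<open>N = \<epsilon>\<^sub>B \<epsilon>\<^sub>T B \<times> T\<close> and \<open>T = \<epsilon>\<^sub>N \<epsilon>\<^sub>B N \<times> B\<close> follow from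
  orthonormality and the formula for \<open>B\<close>. Continuity of \<open>\<kappa>\<close> and \<open>\<tau>\<close> is all the regularity that is
  needed beyond differentiability of the frame.\<close>

definition frenet_apparatus ::
  "real set \<Rightarrow> (real \<Rightarrow> real^3) \<Rightarrow> (real \<Rightarrow> real^3) \<Rightarrow> (real \<Rightarrow> real^3) \<Rightarrow> (real \<Rightarrow> real^3)
     \<Rightarrow> (real \<Rightarrow> real) \<Rightarrow> (real \<Rightarrow> real) \<Rightarrow> bool" where
  "frenet_apparatus I \<alpha> T N B \<kappa> \<tau> \<longleftrightarrow>
     continuous_on I \<kappa> \<and> continuous_on I \<tau> \<and>
     (\<forall>s\<in>I.
        (\<alpha> has_vector_derivative T s) (at s within I) \<and>
        \<bar>eps (T s)\<bar> = 1 \<and> \<bar>eps (N s)\<bar> = 1 \<and> \<bar>eps (B s)\<bar> = 1 \<and>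
        lorentz (T s) (N s) = 0 \<and> lorentz (T s) (B s) = 0 \<and> lorentz (N s) (B s) = 0 \<and>
        B s = (eps (T s) * eps (N s)) *\<^sub>R lorentz_cross (T s) (N s) \<and>
        (T has_vector_derivative \<kappa> s *\<^sub>R N s) (at s within I) \<and>
        (N has_vector_derivative (eps (B s) * \<kappa> s) *\<^sub>R T s + \<tau> s *\<^sub>R B s) (at s within I) \<and>
        (B has_vector_derivative (eps (T s) * \<tau> s) *\<^sub>R N s) (at s within I))"

definition frenet_curve ::
  "real set \<Rightarrow> (real \<Rightarrow> real^3) \<Rightarrow> (real \<Rightarrow> real^3) \<Rightarrow> (real \<Rightarrow> real^3) \<Rightarrow> (real \<Rightarrow> real^3)
     \<Rightarrow> (real \<Rightarrow> real) \<Rightarrow> (real \<Rightarrow> real) \<Rightarrow> bool" where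
  "frenet_curve I \<alpha> T N B \<kappa> \<tau> \<longleftrightarrow>
     unit_speed_curve I \<alpha> \<and> (timelike_curve I \<alpha> \<or> spacelike_curve I \<alpha>) \<and>
     frenet_apparatus I \<alpha> T N B \<kappa> \<tau> \<and> (\<forall>s\<in>I. \<kappa> s \<noteq> 0)"

definition spacelike_type1 ::
  "real set \<Rightarrow> (real \<Rightarrow> real^3) \<Rightarrow> (real \<Rightarrow> real^3) \<Rightarrow> (real \<Rightarrow> real^3) \<Rightarrow> (real \<Rightarrow> real^3) \<Rightarrow> bool" where
  "spacelike_type1 I \<alpha> T N B \<longleftrightarrow> spacelike_curve I \<alpha> \<and>
     (\<forall>s\<in>I. timelike (N s) \<and> spacelike (T s) \<and> spacelike (B s))"

definition spacelike_type2 ::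
  "real set \<Rightarrow> (real \<Rightarrow> real^3) \<Rightarrow> (real \<Rightarrow> real^3) \<Rightarrow> (real \<Rightarrow> real^3) \<Rightarrow> (real \<Rightarrow> real^3) \<Rightarrow> bool" where
  "spacelike_type2 I \<alpha> T N B \<longleftrightarrow> spacelike_curve I \<alpha> \<and>
     (\<forall>s\<in>I. timelike (B s) \<and> spacelike (T s) \<and> spacelike (N s))"

definition frame_field ::
  "(real \<Rightarrow> real^3) \<Rightarrow> (real \<Rightarrow> real^3) \<Rightarrow> (real \<Rightarrow> real^3)
     \<Rightarrow> (real \<Rightarrow> real) \<Rightarrow> (real \<Rightarrow> real) \<Rightarrow> (real \<Rightarrow> real) \<Rightarrow> real \<Rightarrow> real^3" where
  "frame_field T N B u v w s = u s *\<^sub>R T s + v s *\<^sub>R N s + w s *\<^sub>R B s"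

definition X_direction_curve ::
  "real set \<Rightarrow> (real \<Rightarrow> real^3) \<Rightarrow> (real \<Rightarrow> real^3) \<Rightarrow> (real \<Rightarrow> real^3)
     \<Rightarrow> (real \<Rightarrow> real) \<Rightarrow> (real \<Rightarrow> real) \<Rightarrow> (real \<Rightarrow> real) \<Rightarrow> (real \<Rightarrow> real^3) \<Rightarrow> bool" where
  "X_direction_curve I T N B u v w \<beta> \<longleftrightarrow>
     u differentiable_on I \<and> v differentiable_on I \<and> w differentiable_on I \<and>
     (\<exists>\<epsilon>\<in>{1, -1}. \<forall>s\<in>I.
        eps (T s) * (u s)\<^sup>2 + eps (N s) * (v s)\<^sup>2 + eps (B s) * (w s)\<^sup>2 = \<epsilon>) \<and>
     (\<forall>s\<in>I. (\<beta> has_vector_derivative frame_field T N B u v w s) (at s within I)) \<and>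
     (\<exists>T' N' B' \<kappa>' \<tau>'. frenet_curve I \<beta> T' N' B' \<kappa>' \<tau>')"

text \<open>Since the Frenet apparatus is determined only up to the sign change above, the Mannheim
  condition (principal normal of \<open>\<beta>\<close> equals binormal of \<open>\<alpha>\<close>) asks for some Frenet frame of \<open>\<beta>\<close>.\<close>

definition Mannheim_direction_curve ::
  "real set \<Rightarrow> (real \<Rightarrow> real^3) \<Rightarrow> (real \<Rightarrow> real^3) \<Rightarrow> (real \<Rightarrow> real^3)
     \<Rightarrow> (real \<Rightarrow> real) \<Rightarrow> (real \<Rightarrow> real) \<Rightarrow> (real \<Rightarrow> real) \<Rightarrow> (real \<Rightarrow> real^3) \<Rightarrow> bool" where
  "Mannheim_direction_curve I T N B u v w \<beta> \<longleftrightarrow>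
     X_direction_curve I T N B u v w \<beta> \<and>
     (\<exists>T' N' B' \<kappa>' \<tau>'. frenet_curve I \<beta> T' N' B' \<kappa>' \<tau>' \<and> (\<forall>s\<in>I. N' s = B s))"

definition antiderivative_on :: "real set \<Rightarrow> (real \<Rightarrow> real) \<Rightarrow> (real \<Rightarrow> real) \<Rightarrow> bool" where
  "antiderivative_on I k K \<longleftrightarrow> (\<forall>s\<in>I. (K has_real_derivative k s) (at s within I))"

end

theory Submission
  imports Defs
begin

text \<open>The principal normal of \<open>\<beta>\<close> can be taken to be \<open>B\<close> precisely when the derivative of
  \<open>X = u T + v N + w B\<close> is a multiple of \<open>B\<close> and \<open>w = 0\<close>, since \<open>X\<close> is orthogonal to the principal
  normal. By the Frenet equations this is the linear system \<open>u' = - \<epsilon>\<^sub>B \<kappa> v\<close>, \<open>v' = - \<kappa> u\<close>, and \<open>X\<close> being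
  a unit field gives \<open>\<epsilon>\<^sub>T u\<^sup>2 + \<epsilon>\<^sub>N v\<^sup>2 = \<plusminus>1\<close>. If \<open>\<epsilon>\<^sub>B = 1\<close> the point \<open>(u, v)\<close> moves on a branch of a unit
  hyperbola, whose parameter \<open>arsinh\<close> is itself an antiderivative of \<open>\<kappa>\<close>; if \<open>\<epsilon>\<^sub>B = -1\<close> it moves on
  the unit circle, and rotating it back by an antiderivative of \<open>\<kappa>\<close> leaves a constant vector.\<close>

section \<open>Algebra of the Lorentz product and cross product\<close>

lemma lorentz_linear:
  "lorentz (x + y) z = lorentz x z + lorentz y z"
  "lorentz x (y + z) = lorentz x y + lorentz x z"
  "lorentz (c *\<^sub>R x) y = c * lorentz x y"
  "lorentz x (c *\<^sub>R y) = c * lorentz x y"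
  by (simp_all add: lorentz_def distrib_left distrib_right left_diff_distrib right_diff_distrib
      mult.left_commute mult.assoc)

lemma lorentz_commute: "lorentz x y = lorentz y x"
  by (simp add: lorentz_def algebra_simps)

lemma continuous_on_lorentz [continuous_intros]:
  "continuous_on I f \<Longrightarrow> continuous_on I g \<Longrightarrow> continuous_on I (\<lambda>s. lorentz (f s) (g s))"
  unfolding lorentz_def by (intro continuous_intros)

text \<open>Lagrange's identity in Lorentz signature; its right-hand side is the negative of the
  Euclidean one. This sign is what makes \<open>eps (B s)\<close> equal to minus the product of the
  other two signs.\<close>

lemma eps_lorentz_cross: "eps (lorentz_cross x y) = (lorentz x y)\<^sup>2 - eps x * eps y"
  by (simp add: lorentz_def lorentz_cross_def vector_3 power2_eq_square algebra_simps)

lemma lorentz_cross_scaleR: "lorentz_cross x (c *\<^sub>R y) = c *\<^sub>R lorentz_cross x y"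
  by (simp add: lorentz_cross_def vec_eq_iff forall_3 vector_3 algebra_simps)

text \<open>Orthogonality expresses \<open>x$1 * y$1\<close> as the Euclidean product of the spatial
  parts. Cauchy-Schwarz, in the form of the planar Lagrange identity, then contradicts the dominance
  of the time components.\<close>

lemma timelike_not_orthogonal:
  assumes "timelike x" "timelike y"
  shows "lorentz x y \<noteq> 0"
proof
  assume "lorentz x y = 0"
  then have eq: "x$1 * y$1 = x$2 * y$2 + x$3 * y$3" by (simp add: lorentz_def)
  have x: "(x$2)\<^sup>2 + (x$3)\<^sup>2 < (x$1)\<^sup>2" and y: "(y$2)\<^sup>2 + (y$3)\<^sup>2 < (y$1)\<^sup>2"
    using assms by (simp_all add: timelike_def lorentz_def power2_eq_square)
  have "(x$1 * y$1)\<^sup>2 + (x$2 * y$3 - x$3 * y$2)\<^sup>2 = ((x$2)\<^sup>2 + (x$3)\<^sup>2) * ((y$2)\<^sup>2 + (y$3)\<^sup>2)"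
    unfolding eq by (simp add: power2_eq_square algebra_simps)
  also have "\<dots> < (x$1)\<^sup>2 * (y$1)\<^sup>2"
    using x y by (intro mult_strict_mono') auto
  finally show False by (simp add: power_mult_distrib)
qed

section \<open>Constant signs, limit points and antiderivatives on an interval\<close>

lemma connected_nonzero_sign:
  fixes f :: "real \<Rightarrow> real"
  assumes "connected I" "continuous_on I f" "\<And>s. s \<in> I \<Longrightarrow> f s \<noteq> 0"
  obtains \<sigma> :: real where "\<sigma> \<in> {1, -1}" "\<And>s. s \<in> I \<Longrightarrow> 0 < \<sigma> * f s"
proof -
  have conn: "connected (f ` I)"
    using assms connected_continuous_image by blast
  have "(\<forall>s\<in>I. 0 < f s) \<or> (\<forall>s\<in>I. f s < 0)"
  proof (rule ccontr)
    assume "\<not> ?thesis"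
    then obtain s t where "s \<in> I" "t \<in> I" "f s \<le> 0" "0 \<le> f t"
      by (auto simp: not_less)
    then have "0 \<in> f ` I"
      using connectedD_interval[OF conn, of "f s" "f t" 0] by auto
    then show False using assms(3) by auto
  qed
  then show thesis
    using that[of 1] that[of "-1"] by auto
qed

lemma connected_unit_sign:
  fixes f :: "real \<Rightarrow> real"
  assumes "connected I" "continuous_on I f" "\<And>s. s \<in> I \<Longrightarrow> \<bar>f s\<bar> = 1"
  obtains \<sigma> :: real where "\<sigma> \<in> {1, -1}" "\<And>s. s \<in> I \<Longrightarrow> f s = \<sigma>"
proof -
  have "f s \<noteq> 0" if "s \<in> I" for s
    using assms(3)[OF that] by auto
  then obtain \<sigma> :: real where \<sigma>: "\<sigma> \<in> {1, -1}" "\<And>s. s \<in> I \<Longrightarrow> 0 < \<sigma> * f s"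
    using connected_nonzero_sign assms(1,2) by blast
  have "f s = \<sigma>" if "s \<in> I" for s
    using \<sigma>(1) \<sigma>(2)[OF that] assms(3)[OF that] by (auto simp: abs_if split: if_splits)
  with \<sigma>(1) show thesis by (rule that)
qed

text \<open>This makes derivatives within \<open>I\<close> unique. An interval with nonempty
  interior is not a single point, so by connectedness each of its points, endpoints included, is a
  limit point.\<close>

lemma interval_at_within_not_bot:
  fixes I :: "real set"
  assumes "is_interval I" "interior I \<noteq> {}" "s \<in> I"
  shows "at s within I \<noteq> bot"
proof -
  have "\<nexists>x. I = {x}"
    using assms(2) interior_singleton by metis
  then have "s islimpt I"
    using connected_imp_perfect[of I s] assms(1,3) is_interval_connected[of I] by blast
  then show ?thesis by (simp add: trivial_limit_within)
qed

lemma has_real_derivative_transform: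
  fixes f g :: "real \<Rightarrow> real"
  assumes "s \<in> I" "\<And>t. t \<in> I \<Longrightarrow> f t = g t" "(g has_real_derivative d) (at s within I)"
  shows "(f has_real_derivative d) (at s within I)"
  using assms has_derivative_transform unfolding has_field_derivative_def by blast

text \<open>The interval may be open, half-open or unbounded, so the fundamental theorem on a
  compact interval is applied locally. \<open>K\<close> is the signed integral from a base point
  \<open>a\<close>; near \<open>x\<close> it differs by a constant from an integral over a compact
  subinterval that agrees with \<open>I\<close> around \<open>x\<close>.\<close>

lemma antiderivative_on_interval_exists:
  fixes k :: "real \<Rightarrow> real"
  assumes I: "is_interval I" and k: "continuous_on I k"
  obtains K where "antiderivative_on I k K"
proof (cases "I = {}")
  case True
  then show thesis using that[of "\<lambda>_. 0"] by (simp add: antiderivative_on_def)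
next
  case False
  then obtain a where a: "a \<in> I" by auto
  have sub: "{p..q} \<subseteq> I" if "p \<in> I" "q \<in> I" for p q
    using mem_is_interval_1_I[OF I that] by auto
  have int: "k integrable_on {p..q}" if "p \<in> I" "q \<in> I" for p q
    using integrable_continuous_real continuous_on_subset[OF k sub[OF that]] by blast
  define K where "K = (\<lambda>x. if a \<le> x then integral {a..x} k else - integral {x..a} k)"
  have K_diff: "K y = K p + integral {p..y} k" if "p \<in> I" "y \<in> I" "p \<le> y" for p y
  proof -
    consider "a \<le> p" | "p < a" "a \<le> y" | "y < a" by linarith
    then show ?thesis
    proof cases
      case 1
      then show ?thesis
        using Henstock_Kurzweil_Integration.integral_combine[of a p y k] int[OF a that(2)] that(3)
        by (simp add: K_def)
    next
      case 2
      then show ?thesis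
        using Henstock_Kurzweil_Integration.integral_combine[of p a y k] int[OF that(1,2)] by (simp add: K_def)
    next
      case 3
      then show ?thesis
        using Henstock_Kurzweil_Integration.integral_combine[of p y a k] int[OF that(1) a] that(3)
        by (simp add: K_def)
    qed
  qed
  have "(K has_real_derivative k x) (at x within I)" if x: "x \<in> I" for x
  proof -
    \<comment> \<open>If \<open>x\<close> is the left end of \<open>I\<close>, then \<open>p\<close>
      is \<open>x\<close> itself; otherwise \<open>p\<close> lies strictly to the left. The point
      \<open>q\<close> is chosen symmetrically.\<close>
    have "\<exists>p\<in>I. p \<le> x \<and> (p < x \<or> (\<forall>y\<in>I. x \<le> y))"
      using x by (cases "\<exists>p\<in>I. p < x") (auto simp: not_less intro: less_imp_le)
    then obtain p where p: "p \<in> I" "p \<le> x" "p < x \<or> (\<forall>y\<in>I. x \<le> y)" by blast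
    have "\<exists>q\<in>I. x \<le> q \<and> (x < q \<or> (\<forall>y\<in>I. y \<le> x))"
      using x by (cases "\<exists>q\<in>I. x < q") (auto simp: not_less intro: less_imp_le)
    then obtain q where q: "q \<in> I" "x \<le> q" "x < q \<or> (\<forall>y\<in>I. y \<le> x)" by blast
    \<comment> \<open>An open neighbourhood of \<open>x\<close> in which \<open>I\<close> and
      \<open>{p..q}\<close> coincide. The bounds \<open>x - 1\<close> and \<open>x + 1\<close> occur
      only at an end of \<open>I\<close>; there any room beyond \<open>x\<close> would do, since
      \<open>I\<close> has no points on that side.\<close>
    define S where "S = {if p < x then p else x - 1 <..< if x < q then q else x + 1}"
    have nhd: "I \<inter> S - {x} = {p..q} \<inter> S - {x}"
    proof -
      have "p \<le> y" if "y \<in> I" "y \<in> S" for y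
        using that p by (cases "p < x") (auto simp: S_def)
      moreover have "y \<le> q" if "y \<in> I" "y \<in> S" for y
        using that q by (cases "x < q") (auto simp: S_def)
      ultimately show ?thesis using sub[OF p(1) q(1)] by auto
    qed
    have "x \<in> S" "open S" by (auto simp: S_def)
    then have at_eq: "at x within I = at x within {p..q}"
      using at_within_nhd nhd by blast
    have int': "((\<lambda>y. integral {p..y} k) has_real_derivative k x) (at x within {p..q})"
      using p(2) q(2)
      by (intro integral_has_real_derivative continuous_on_subset[OF k sub[OF p(1) q(1)]]) simp
    have deriv: "((\<lambda>y. K p + integral {p..y} k) has_real_derivative k x) (at x within {p..q})"
      using DERIV_add[OF DERIV_const[of "K p"] int'] by simp
    have K_eq: "K y = K p + integral {p..y} k" if "y \<in> {p..q}" for y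
      using that sub[OF p(1) q(1)] by (intro K_diff p(1)) auto
    have "x \<in> {p..q}" using p(2) q(2) by simp
    then show ?thesis
      unfolding at_eq using K_eq deriv by (rule has_real_derivative_transform)
  qed
  then show thesis
    using that[of K] unfolding antiderivative_on_def by blast
qed

section \<open>Solving the linear systems for the coefficients\<close>

lemma hyperbolic_rotation_ode:
  fixes u v k :: "real \<Rightarrow> real"
  assumes I: "connected I"
    and u: "\<And>s. s \<in> I \<Longrightarrow> (u has_real_derivative - k s * v s) (at s within I)"
    and v: "\<And>s. s \<in> I \<Longrightarrow> (v has_real_derivative - k s * u s) (at s within I)"
    and uv: "\<And>s. s \<in> I \<Longrightarrow> (u s)\<^sup>2 - (v s)\<^sup>2 = 1"
  obtains K \<sigma> where "antiderivative_on I k K" "\<sigma> \<in> {1, -1}"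
    "\<And>s. s \<in> I \<Longrightarrow> u s = \<sigma> * (- cosh (K s))" "\<And>s. s \<in> I \<Longrightarrow> v s = \<sigma> * sinh (K s)"
proof -
  have "continuous_on I u"
    by (rule DERIV_continuous_on) (rule u)
  moreover have "u s \<noteq> 0" if "s \<in> I" for s
  proof
    assume "u s = 0"
    then have "(v s)\<^sup>2 = -1" using uv[OF that] by simp
    then show False using zero_le_power2[of "v s"] by linarith
  qed
  \<comment> \<open>\<open>\<rho>\<close> names the branch of the hyperbola. Since
    \<open>cosh\<close> is positive, no shift of the parameter passes to the other branch, so the
    sign survives in the result as \<open>\<sigma> = - \<rho>\<close>.\<close>
  ultimately obtain \<rho> :: real where \<rho>: "\<rho> \<in> {1, -1}" and pos: "\<And>s. s \<in> I \<Longrightarrow> 0 < \<rho> * u s"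
    using connected_nonzero_sign[OF I] by blast
  have \<rho>2: "\<rho>\<^sup>2 = 1" "\<rho> * \<rho> = 1" using \<rho> by auto
  \<comment> \<open>Forced by the desired equation \<open>v s = - \<rho> * sinh (K s)\<close>. The
    chain rule gives the derivative \<open>\<rho> * k s * u s\<close> divided by
    \<open>cosh (K s) = \<rho> * u s\<close>, which is \<open>k s\<close>.\<close>
  define K where "K s = arsinh (- \<rho> * v s)" for s
  have sqrt_eq: "sqrt ((- \<rho> * v s)\<^sup>2 + 1) = \<rho> * u s" if "s \<in> I" for s
  proof -
    have "(- \<rho> * v s)\<^sup>2 + 1 = (\<rho> * u s)\<^sup>2"
      using uv[OF that] \<rho>2 by (simp add: power_mult_distrib)
    then show ?thesis using pos[OF that] by simp
  qed
  have sinh_K: "sinh (K s) = - \<rho> * v s" for s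
    by (simp add: K_def)
  have cosh_K: "cosh (K s) = \<rho> * u s" if "s \<in> I" for s
    using sqrt_eq[OF that] by (simp add: K_def cosh_arsinh_real)
  have "(K has_real_derivative k s) (at s within I)" if s: "s \<in> I" for s
  proof -
    have "(K has_real_derivative (1 / sqrt ((- \<rho> * v s)\<^sup>2 + 1)) * (- \<rho> * (- k s * u s))) (at s within I)"
      unfolding K_def
      by (rule DERIV_chain2[OF arsinh_real_has_field_derivative]) (intro DERIV_cmult v s)
    moreover have "(1 / sqrt ((- \<rho> * v s)\<^sup>2 + 1)) * (- \<rho> * (- k s * u s)) = k s"
      unfolding sqrt_eq[OF s] using pos[OF s] by (auto simp: field_simps)
    ultimately show ?thesis by simp
  qed
  moreover have "u s = - \<rho> * (- cosh (K s))" "v s = - \<rho> * sinh (K s)" if "s \<in> I" for s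
    by (simp_all add: cosh_K[OF that] sinh_K \<rho>2 mult.assoc[symmetric])
  ultimately show thesis
    using that[of K "- \<rho>"] \<rho> unfolding antiderivative_on_def by auto
qed

text \<open>The point \<open>(u, v)\<close> runs on the unit circle with angular velocity
  \<open>- k\<close>, so turning it by an antiderivative of \<open>k\<close> stops it. The remaining
  constant angle goes into the additive constant of \<open>K\<close>, and with it any sign, since
  negation is a rotation by half a turn.\<close>

lemma rotation_ode:
  fixes u v k :: "real \<Rightarrow> real"
  assumes I: "is_interval I" and k: "continuous_on I k"
    and u: "\<And>s. s \<in> I \<Longrightarrow> (u has_real_derivative k s * v s) (at s within I)"
    and v: "\<And>s. s \<in> I \<Longrightarrow> (v has_real_derivative - k s * u s) (at s within I)"
    and uv: "\<And>s. s \<in> I \<Longrightarrow> (u s)\<^sup>2 + (v s)\<^sup>2 = 1"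
  obtains K where "antiderivative_on I k K"
    "\<And>s. s \<in> I \<Longrightarrow> u s = - cos (K s)" "\<And>s. s \<in> I \<Longrightarrow> v s = sin (K s)"
proof (cases "I = {}")
  case True
  then show thesis using that[of "\<lambda>_. 0"] by (simp add: antiderivative_on_def)
next
  case False
  then obtain a where a: "a \<in> I" by auto
  obtain L where L: "antiderivative_on I k L"
    using antiderivative_on_interval_exists[OF I k] by blast
  \<comment> \<open>\<open>(f, g)\<close> is \<open>(u, v)\<close> rotated by the angle
    \<open>L s\<close>; the rotation is undone in \<open>rot\<close>.\<close>
  define f where "f s = u s * cos (L s) - v s * sin (L s)" for s
  define g where "g s = u s * sin (L s) + v s * cos (L s)" for s
  have L': "(L has_real_derivative k s) (at s within I)" if "s \<in> I" for s
    using L that by (simp add: antiderivative_on_def)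
  have "(f has_real_derivative 0) (at s within I)" "(g has_real_derivative 0) (at s within I)"
    if "s \<in> I" for s
    unfolding f_def[abs_def] g_def[abs_def]
    using that by (auto intro!: derivative_eq_intros L' u v simp: algebra_simps)
  then have const: "f s = f a" "g s = g a" if "s \<in> I" for s
    using has_field_derivative_zero_constant[OF is_interval_convex[OF I], of f]
      has_field_derivative_zero_constant[OF is_interval_convex[OF I], of g] a that
    by metis+
  have rot: "u s = f s * cos (L s) + g s * sin (L s)" "v s = g s * cos (L s) - f s * sin (L s)" for s
  proof -
    have "(cos (L s))\<^sup>2 = 1 - (sin (L s))\<^sup>2" by (simp add: cos_squared_eq)
    then show "u s = f s * cos (L s) + g s * sin (L s)" "v s = g s * cos (L s) - f s * sin (L s)"
      unfolding f_def g_def by algebra+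
  qed
  have "(f a)\<^sup>2 + (g a)\<^sup>2 = ((u a)\<^sup>2 + (v a)\<^sup>2) * ((sin (L a))\<^sup>2 + (cos (L a))\<^sup>2)"
    unfolding f_def g_def by algebra
  then have "(- f a)\<^sup>2 + (g a)\<^sup>2 = 1" using uv[OF a] by simp
  \<comment> \<open>The angle of the constant point, with the first coordinate negated to match the
    normal form \<open>(- cos, sin)\<close>.\<close>
  then obtain c where c: "- f a = cos c" "g a = sin c"
    using sincos_total_2pi by metis
  have "f a = - cos c" using c by simp
  then have "u s = - cos (L s + c)" "v s = sin (L s + c)" if "s \<in> I" for s
    using that by (simp_all add: rot const \<open>f a = - cos c\<close> c(2) cos_add sin_add)
  moreover have "antiderivative_on I k (\<lambda>s. L s + c)"
    using L' by (auto simp: antiderivative_on_def intro!: derivative_eq_intros)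
  ultimately show thesis using that by blast
qed

section \<open>Frenet frames: causal signs and the sign change of the frame\<close>

lemma frenet_curveD:
  assumes "frenet_curve I \<alpha> T N B \<kappa> \<tau>" "s \<in> I"
  shows "(\<alpha> has_vector_derivative T s) (at s within I)"
    "\<bar>eps (T s)\<bar> = 1" "\<bar>eps (N s)\<bar> = 1" "\<bar>eps (B s)\<bar> = 1"
    "lorentz (T s) (N s) = 0" "lorentz (T s) (B s) = 0" "lorentz (N s) (B s) = 0"
    "B s = (eps (T s) * eps (N s)) *\<^sub>R lorentz_cross (T s) (N s)"
    "(T has_vector_derivative \<kappa> s *\<^sub>R N s) (at s within I)"
    "(N has_vector_derivative (eps (B s) * \<kappa> s) *\<^sub>R T s + \<tau> s *\<^sub>R B s) (at s within I)"
    "(B has_vector_derivative (eps (T s) * \<tau> s) *\<^sub>R N s) (at s within I)"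
    "\<kappa> s \<noteq> 0"
  using assms by (auto simp: frenet_curve_def frenet_apparatus_def)

lemma frenet_curve_continuous:
  assumes "frenet_curve I \<alpha> T N B \<kappa> \<tau>"
  shows "continuous_on I T" "continuous_on I N" "continuous_on I B"
    "continuous_on I \<kappa>" "continuous_on I \<tau>"
proof -
  show "continuous_on I T" "continuous_on I N" "continuous_on I B"
    using frenet_curveD(9-11)[OF assms]
    by (meson continuous_on_eq_continuous_within has_vector_derivative_continuous)+
  show "continuous_on I \<kappa>" "continuous_on I \<tau>"
    using assms by (auto simp: frenet_curve_def frenet_apparatus_def)
qed

text \<open>Lagrange's identity applied to the cross product formula for \<open>B\<close>, with
  \<open>T\<close> orthogonal to \<open>N\<close>.\<close>

lemma frenet_eps_binormal:
  assumes "frenet_curve I \<alpha> T N B \<kappa> \<tau>" "s \<in> I"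
  shows "eps (B s) = - eps (T s) * eps (N s)"
proof -
  note F = frenet_curveD[OF assms]
  have sq: "(eps (T s) * eps (N s))\<^sup>2 = 1"
    using F(2,3) by (simp add: abs_square_eq_1 abs_mult)
  have "eps (B s) = (eps (T s) * eps (N s))\<^sup>2 * eps (lorentz_cross (T s) (N s))"
    by (subst (1 2) F(8)) (simp add: lorentz_linear power2_eq_square)
  then show ?thesis using sq F(5) by (simp add: eps_lorentz_cross)
qed

lemma frenet_eps_timelike:
  assumes "frenet_curve I \<alpha> T N B \<kappa> \<tau>" "s \<in> I" "timelike (T s)"
  shows "eps (T s) = -1" "eps (N s) = 1" "eps (B s) = 1"
proof -
  note F = frenet_curveD[OF assms(1,2)]
  show T: "eps (T s) = -1" using F(2) assms(3) by (auto simp: timelike_def)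
  have "\<not> timelike (N s)" using timelike_not_orthogonal[OF assms(3)] F(5) by auto
  then show "eps (N s) = 1" using F(3) by (auto simp: timelike_def)
  then show "eps (B s) = 1" using frenet_eps_binormal[OF assms(1,2)] T by simp
qed

lemma eps_spacelike:
  assumes "spacelike x" "\<bar>eps x\<bar> = 1"
  shows "eps x = 1"
  using assms by (auto simp: spacelike_def lorentz_def)

lemma frenet_velocity:
  assumes "is_interval I" "interior I \<noteq> {}" "frenet_curve I \<alpha> T N B \<kappa> \<tau>" "s \<in> I"
  shows "velocity I \<alpha> s = T s"
  unfolding velocity_def
  by (intro vector_derivative_within interval_at_within_not_bot frenet_curveD(1)) (use assms in auto)

text \<open>Serves to exchange a frame of \<open>\<beta>\<close> whose principal normal is
  \<open>-B\<close> for one whose principal normal is \<open>B\<close>. Tangent and torsion are kept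
  because the two sign factors cancel in each Frenet equation that contains them.\<close>

lemma frenet_curve_sign:
  assumes F: "frenet_curve I \<beta> T N B \<kappa> \<tau>" and c: "c \<in> {1, -1}"
  shows "frenet_curve I \<beta> T (\<lambda>s. c *\<^sub>R N s) (\<lambda>s. c *\<^sub>R B s) (\<lambda>s. c * \<kappa> s) \<tau>"
proof -
  note D = frenet_curveD[OF F]
  have cc: "c * c = 1" "c * (c * x) = x" for x :: real using c by auto
  have eps_c: "eps (c *\<^sub>R x) = eps x" for x
    by (simp add: lorentz_linear cc)
  show ?thesis
    unfolding frenet_curve_def frenet_apparatus_def eps_c
  proof (intro conjI ballI)
    show "unit_speed_curve I \<beta>" "timelike_curve I \<beta> \<or> spacelike_curve I \<beta>" "continuous_on I \<tau>"
      using F by (auto simp: frenet_curve_def frenet_apparatus_def)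
    show "continuous_on I (\<lambda>s. c * \<kappa> s)"
      by (intro continuous_intros frenet_curve_continuous[OF F])
  next
    fix s assume s: "s \<in> I"
    show "(\<beta> has_vector_derivative T s) (at s within I)"
      "\<bar>eps (T s)\<bar> = 1" "\<bar>eps (N s)\<bar> = 1" "\<bar>eps (B s)\<bar> = 1"
      by (intro D s)+
    show "lorentz (T s) (c *\<^sub>R N s) = 0" "lorentz (T s) (c *\<^sub>R B s) = 0"
      "lorentz (c *\<^sub>R N s) (c *\<^sub>R B s) = 0"
      by (simp_all add: lorentz_linear D(5-7)[OF s])
    show "c *\<^sub>R B s = (eps (T s) * eps (N s)) *\<^sub>R lorentz_cross (T s) (c *\<^sub>R N s)"
      by (subst D(8)[OF s]) (simp add: lorentz_cross_scaleR mult.commute)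
    have "(c * \<kappa> s) *\<^sub>R c *\<^sub>R N s = \<kappa> s *\<^sub>R N s"
      by (simp add: cc mult.commute)
    then show "(T has_vector_derivative (c * \<kappa> s) *\<^sub>R c *\<^sub>R N s) (at s within I)"
      using D(9)[OF s] by (simp only:)
    have "c *\<^sub>R ((eps (B s) * \<kappa> s) *\<^sub>R T s + \<tau> s *\<^sub>R B s)
        = (eps (B s) * (c * \<kappa> s)) *\<^sub>R T s + \<tau> s *\<^sub>R c *\<^sub>R B s"
      by (simp add: scaleR_add_right mult.commute mult.left_commute)
    then show "((\<lambda>s. c *\<^sub>R N s) has_vector_derivative
        (eps (B s) * (c * \<kappa> s)) *\<^sub>R T s + \<tau> s *\<^sub>R c *\<^sub>R B s) (at s within I)"
      using bounded_linear.has_vector_derivative[OF bounded_linear_scaleR_right D(10)[OF s], of c]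
      by (simp only:)
    have "c *\<^sub>R ((eps (T s) * \<tau> s) *\<^sub>R N s) = (eps (T s) * \<tau> s) *\<^sub>R c *\<^sub>R N s"
      by (simp add: mult.commute)
    then show "((\<lambda>s. c *\<^sub>R B s) has_vector_derivative (eps (T s) * \<tau> s) *\<^sub>R c *\<^sub>R N s)
        (at s within I)"
      using bounded_linear.has_vector_derivative[OF bounded_linear_scaleR_right D(11)[OF s], of c]
      by (simp only:)
    show "c * \<kappa> s \<noteq> 0"
      using c D(12)[OF s] by auto
  qed
qed

section \<open>Differentiating \<open>X\<close> and reducing the Mannheim condition to a linear
  system\<close>

lemma frame_field_has_vector_derivative:
  assumes F: "frenet_curve I \<alpha> T N B \<kappa> \<tau>" "s \<in> I"
    and "(u has_real_derivative u') (at s within I)"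
    and "(v has_real_derivative v') (at s within I)"
    and "(w has_real_derivative w') (at s within I)"
  shows "(frame_field T N B u v w has_vector_derivative
      frame_field T N B (\<lambda>_. u' + eps (B s) * \<kappa> s * v s)
        (\<lambda>_. v' + \<kappa> s * u s + eps (T s) * \<tau> s * w s) (\<lambda>_. w' + \<tau> s * v s) s) (at s within I)"
proof -
  note D = frenet_curveD[OF F]
  have "((\<lambda>s. u s *\<^sub>R T s + v s *\<^sub>R N s + w s *\<^sub>R B s) has_vector_derivative
      (u s *\<^sub>R (\<kappa> s *\<^sub>R N s) + u' *\<^sub>R T s)
      + (v s *\<^sub>R ((eps (B s) * \<kappa> s) *\<^sub>R T s + \<tau> s *\<^sub>R B s) + v' *\<^sub>R N s)
      + (w s *\<^sub>R ((eps (T s) * \<tau> s) *\<^sub>R N s) + w' *\<^sub>R B s)) (at s within I)"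
    by (intro derivative_intros D assms)
  \<comment> \<open>Collecting the product rule terms by \<open>T\<close>, \<open>N\<close> and
    \<open>B\<close> makes the derivative a frame field again, so that
    \<open>lorentz_frame_field\<close> can read off its components.\<close>
  then show ?thesis
    by (simp add: frame_field_def[abs_def] algebra_simps)
qed

lemma lorentz_frame_field:
  assumes F: "frenet_curve I \<alpha> T N B \<kappa> \<tau>" "s \<in> I"
  shows "lorentz (frame_field T N B u v w s) (T s) = eps (T s) * u s"
    "lorentz (frame_field T N B u v w s) (N s) = eps (N s) * v s"
    "lorentz (frame_field T N B u v w s) (B s) = eps (B s) * w s"
    "eps (frame_field T N B u v w s)
      = eps (T s) * (u s)\<^sup>2 + eps (N s) * (v s)\<^sup>2 + eps (B s) * (w s)\<^sup>2"
  using frenet_curveD(5-7)[OF F] lorentz_commute[of "N s" "T s"] lorentz_commute[of "B s" "T s"]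
    lorentz_commute[of "B s" "N s"]
  by (simp_all add: frame_field_def lorentz_linear power2_eq_square algebra_simps)

text \<open>Forwards, \<open>X\<close> is orthogonal to the principal normal \<open>B\<close>, and
  its derivative is a multiple of \<open>B\<close>, so the \<open>T\<close> and \<open>N\<close>
  components of that derivative vanish. Backwards, the system leaves only a \<open>B\<close>
  component, which determines the principal normal of \<open>\<beta>\<close> up to a sign that
  continuity keeps constant.\<close>

lemma Mannheim_direction_curve_iff_ode:
  assumes I: "is_interval I" "interior I \<noteq> {}"
    and F: "frenet_curve I \<alpha> T N B \<kappa> \<tau>"
    and X: "X_direction_curve I T N B u v w \<beta>"
  shows "Mannheim_direction_curve I T N B u v w \<beta> \<longleftrightarrow>
    (\<forall>s\<in>I. w s = 0 \<and> (u has_real_derivative - eps (B s) * \<kappa> s * v s) (at s within I)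
      \<and> (v has_real_derivative - \<kappa> s * u s) (at s within I))"
    (is "?M \<longleftrightarrow> ?ode")
proof -
  let ?X = "frame_field T N B u v w"
  have nb: "at s within I \<noteq> bot" if "s \<in> I" for s
    by (intro interval_at_within_not_bot I that)
  have \<beta>': "(\<beta> has_vector_derivative ?X s) (at s within I)" if "s \<in> I" for s
    using X that by (simp add: X_direction_curve_def)
  \<comment> \<open>Every Frenet tangent of \<open>\<beta>\<close> agrees with \<open>X\<close> on
    \<open>I\<close> by uniqueness of derivatives, so the first Frenet equation of
    \<open>\<beta>\<close> becomes a statement about the derivative of \<open>X\<close>.\<close>
  have tangent: "(?X has_vector_derivative \<kappa>' s *\<^sub>R N' s) (at s within I)" and
    T'_eq: "T' s = ?X s"
    if F': "frenet_curve I \<beta> T' N' B' \<kappa>' \<tau>'" and s: "s \<in> I" for T' N' B' \<kappa>' \<tau>' s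
  proof -
    have T': "T' s = ?X s" if "s \<in> I" for s
      using vector_derivative_unique_within[OF nb[OF that] frenet_curveD(1)[OF F' that] \<beta>'[OF that]] .
    show "(?X has_vector_derivative \<kappa>' s *\<^sub>R N' s) (at s within I)"
      using has_vector_derivative_transform[OF s _ frenet_curveD(9)[OF F' s]] T' by metis
    show "T' s = ?X s" by (rule T'[OF s])
  qed
  show ?thesis
  proof
    assume ?M
    then obtain T' N' B' \<kappa>' \<tau>' where F': "frenet_curve I \<beta> T' N' B' \<kappa>' \<tau>'"
      and N': "\<And>s. s \<in> I \<Longrightarrow> N' s = B s"
      by (auto simp: Mannheim_direction_curve_def)
    have w: "w s = 0" if "s \<in> I" for s
      using frenet_curveD(5)[OF F' that] T'_eq[OF F' that] N'[OF that] lorentz_frame_field(3)[OF F that]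
        frenet_curveD(4)[OF F that] by auto
    have "(u has_real_derivative - eps (B s) * \<kappa> s * v s) (at s within I)
      \<and> (v has_real_derivative - \<kappa> s * u s) (at s within I)" if s: "s \<in> I" for s
    proof -
      obtain u' v' w' where d: "(u has_real_derivative u') (at s within I)"
        "(v has_real_derivative v') (at s within I)" "(w has_real_derivative w') (at s within I)"
        using X s unfolding X_direction_curve_def differentiable_on_def
        by (meson real_differentiable_def)
      let ?Y = "frame_field T N B (\<lambda>_. u' + eps (B s) * \<kappa> s * v s)
        (\<lambda>_. v' + \<kappa> s * u s + eps (T s) * \<tau> s * w s) (\<lambda>_. w' + \<tau> s * v s) s"
      have "?Y = \<kappa>' s *\<^sub>R B s"
        using vector_derivative_unique_within[OF nb[OF s]
            frame_field_has_vector_derivative[OF F s d] tangent[OF F' s]] N'[OF s] by simp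
      moreover have "lorentz (B s) (T s) = 0" "lorentz (B s) (N s) = 0"
        using frenet_curveD(6,7)[OF F s] by (simp_all add: lorentz_commute)
      ultimately have "lorentz ?Y (T s) = 0" "lorentz ?Y (N s) = 0"
        by (simp_all add: lorentz_linear)
      then have "u' + eps (B s) * \<kappa> s * v s = 0" "v' + \<kappa> s * u s = 0"
        using frenet_curveD(2,3)[OF F s] w[OF s] by (auto simp: lorentz_frame_field[OF F s])
      then have "u' = - eps (B s) * \<kappa> s * v s" "v' = - \<kappa> s * u s"
        by linarith+
      then show ?thesis using d by simp
    qed
    with w show ?ode by blast
  next
    assume ode: ?ode
    \<comment> \<open>Some frame of \<open>\<beta>\<close> exists by hypothesis, as yet unrelated to
      \<open>B\<close>; it is corrected by a sign below.\<close>
    obtain T' N' B' \<kappa>' \<tau>' where F': "frenet_curve I \<beta> T' N' B' \<kappa>' \<tau>'"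
      using X by (auto simp: X_direction_curve_def)
    have par: "\<kappa>' s *\<^sub>R N' s = (\<tau> s * v s) *\<^sub>R B s" if s: "s \<in> I" for s
    proof -
      have "(w has_real_derivative 0) (at s within I)"
        using ode s by (intro has_real_derivative_transform[OF s _ DERIV_const[of 0]]) simp
      then have "(?X has_vector_derivative (\<tau> s * v s) *\<^sub>R B s) (at s within I)"
        using frame_field_has_vector_derivative[OF F s, of u _ v _ w 0] ode s
        by (fastforce simp: frame_field_def)
      then show ?thesis
        using vector_derivative_unique_within[OF nb[OF s] tangent[OF F' s]] by blast
    qed
    \<comment> \<open>The coefficient of \<open>N'\<close> along \<open>B\<close>, written as a
      pairing of continuous fields so that its continuity is immediate. It equals the quotient
      \<open>d\<close> below because \<open>eps (B s)\<close> squares to 1.\<close>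
    define c where "c s = lorentz (N' s) (B s) * eps (B s)" for s
    have N'_eq: "N' s = c s *\<^sub>R B s" and c_abs: "\<bar>c s\<bar> = 1" if s: "s \<in> I" for s
    proof -
      have \<kappa>': "\<kappa>' s \<noteq> 0" using frenet_curveD(12)[OF F' s] .
      define d where "d = \<tau> s * v s / \<kappa>' s"
      have "N' s = inverse (\<kappa>' s) *\<^sub>R (\<kappa>' s *\<^sub>R N' s)" using \<kappa>' by simp
      then have N'd: "N' s = d *\<^sub>R B s"
        unfolding par[OF s] by (simp add: d_def field_simps)
      have e: "eps (B s) * eps (B s) = 1"
        using frenet_curveD(4)[OF F s] by (metis abs_mult_self_eq mult_1)
      have "c s = d" using e by (simp add: c_def N'd lorentz_linear mult.assoc)
      then show "N' s = c s *\<^sub>R B s" using N'd by simp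
      have "\<bar>d * d\<bar> = 1"
        using frenet_curveD(3)[OF F' s] frenet_curveD(4)[OF F s]
        by (simp add: N'd lorentz_linear abs_mult)
      then show "\<bar>c s\<bar> = 1"
        unfolding \<open>c s = d\<close> by (metis abs_mult_self_eq abs_idempotent abs_mult real_sqrt_abs2 real_sqrt_one)
    qed
    have "continuous_on I c"
      unfolding c_def[abs_def] by (intro continuous_intros frenet_curve_continuous[OF F]
        frenet_curve_continuous[OF F'])
    then obtain \<sigma> :: real where \<sigma>: "\<sigma> \<in> {1, -1}" "\<And>s. s \<in> I \<Longrightarrow> c s = \<sigma>"
      using connected_unit_sign[OF is_interval_connected[OF I(1)]] c_abs by blast
    have "\<sigma> *\<^sub>R N' s = B s" if "s \<in> I" for s
      using N'_eq[OF that] \<sigma>(1) \<sigma>(2)[OF that] by auto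
    with frenet_curve_sign[OF F' \<sigma>(1)] X show ?M
      unfolding Mannheim_direction_curve_def by blast
  qed
qed

section \<open>The explicit coefficients, by causal type of the curve and of
  \<open>X\<close>\<close>

theorem theorem4p1:
  fixes I :: "real set"
    and \<alpha> \<beta> T N B X :: "real \<Rightarrow> real^3"
    and \<kappa> \<tau> u v w :: "real \<Rightarrow> real"
  assumes "is_interval I" and "interior I \<noteq> {}"
    and "frenet_curve I \<alpha> T N B \<kappa> \<tau>"
    and "X = frame_field T N B u v w"
    and "X_direction_curve I T N B u v w \<beta>"
  shows "Mannheim_direction_curve I T N B u v w \<beta> \<longleftrightarrow>
    (\<exists>K. antiderivative_on I \<kappa> K \<and>
      (((timelike_curve I \<alpha> \<and> (\<forall>s\<in>I. timelike (X s)) \<or>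
         spacelike_type1 I \<alpha> T N B \<and> (\<forall>s\<in>I. spacelike (X s))) \<and>
        (\<exists>\<sigma>\<in>{1, -1}. \<forall>s\<in>I. u s = \<sigma> * (- cosh (K s)) \<and> v s = \<sigma> * sinh (K s) \<and> w s = 0))
     \<or> ((timelike_curve I \<alpha> \<and> (\<forall>s\<in>I. spacelike (X s)) \<or>
         spacelike_type1 I \<alpha> T N B \<and> (\<forall>s\<in>I. timelike (X s))) \<and>
        (\<exists>\<sigma>\<in>{1, -1}. \<forall>s\<in>I. u s = \<sigma> * sinh (K s) \<and> v s = \<sigma> * (- cosh (K s)) \<and> w s = 0))
     \<or> ((spacelike_type2 I \<alpha> T N B \<and> (\<forall>s\<in>I. spacelike (X s))) \<and>
        (\<forall>s\<in>I. u s = - cos (K s) \<and> v s = sin (K s) \<and> w s = 0))))"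
    (is "?M \<longleftrightarrow> (\<exists>K. _ \<and> (?hyp_i \<and> ?sol_i K \<or> ?hyp_ii \<and> ?sol_ii K \<or> ?hyp_iii \<and> ?sol_iii K))")
proof -
  note I = assms(1,2) and F = assms(3)
  have conn: "connected I" by (rule is_interval_connected[OF I(1)])
  obtain a where a: "a \<in> I" using I(2) interior_subset by blast
  note D = frenet_curveD[OF F]
  have vel: "velocity I \<alpha> s = T s" if "s \<in> I" for s
    by (rule frenet_velocity[OF I F that])
  note ode_iff = Mannheim_direction_curve_iff_ode[OF I F assms(5)]
  show ?thesis
  proof
    assume ?M
    then have w: "w s = 0"
      and u: "(u has_real_derivative - eps (B s) * \<kappa> s * v s) (at s within I)"
      and v: "(v has_real_derivative - \<kappa> s * u s) (at s within I)" if "s \<in> I" for s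
      using that unfolding ode_iff by blast+
    obtain \<epsilon> where \<epsilon>: "\<epsilon> \<in> {1, -1}"
      "\<And>s. s \<in> I \<Longrightarrow> eps (T s) * (u s)\<^sup>2 + eps (N s) * (v s)\<^sup>2 + eps (B s) * (w s)\<^sup>2 = \<epsilon>"
      using assms(5) by (auto simp: X_direction_curve_def)
    have unit: "eps (T s) * (u s)\<^sup>2 + eps (N s) * (v s)\<^sup>2 = \<epsilon>" if "s \<in> I" for s
      using \<epsilon>(2)[OF that] w[OF that] by simp
    \<comment> \<open>The constant \<open>\<epsilon>\<close> of the normalisation is the Lorentz
      square of \<open>X\<close>, so it decides the causal character of \<open>X\<close> on all of
      \<open>I\<close>.\<close>
    have eps_X: "eps (X s) = \<epsilon>" if "s \<in> I" for s
      using \<epsilon>(2)[OF that] lorentz_frame_field(4)[OF F that] assms(4) by simp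
    have X_time: "\<forall>s\<in>I. timelike (X s)" if "\<epsilon> = -1"
      using eps_X that by (simp add: timelike_def)
    have X_space: "\<forall>s\<in>I. spacelike (X s)" if "\<epsilon> = 1"
      using eps_X that by (simp add: spacelike_def)
    have sol_i: "\<exists>K. antiderivative_on I \<kappa> K \<and> ?sol_i K"
      if B1: "\<And>s. s \<in> I \<Longrightarrow> eps (B s) = 1" and rel: "\<And>s. s \<in> I \<Longrightarrow> (u s)\<^sup>2 - (v s)\<^sup>2 = 1"
    proof -
      have "(u has_real_derivative - \<kappa> s * v s) (at s within I)" if "s \<in> I" for s
        using u[OF that] B1[OF that] by simp
      then obtain K \<sigma> where "antiderivative_on I \<kappa> K" "\<sigma> \<in> {1, -1}"
        "\<And>s. s \<in> I \<Longrightarrow> u s = \<sigma> * (- cosh (K s))" "\<And>s. s \<in> I \<Longrightarrow> v s = \<sigma> * sinh (K s)"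
        using hyperbolic_rotation_ode[OF conn _ v rel] by blast
      then show ?thesis using w by blast
    qed
    \<comment> \<open>For \<open>eps (B s) = 1\<close> the system is symmetric in \<open>u\<close>
      and \<open>v\<close>, so the same lemma applies with their roles exchanged.\<close>
    have sol_ii: "\<exists>K. antiderivative_on I \<kappa> K \<and> ?sol_ii K"
      if B1: "\<And>s. s \<in> I \<Longrightarrow> eps (B s) = 1" and rel: "\<And>s. s \<in> I \<Longrightarrow> (v s)\<^sup>2 - (u s)\<^sup>2 = 1"
    proof -
      have "(u has_real_derivative - \<kappa> s * v s) (at s within I)" if "s \<in> I" for s
        using u[OF that] B1[OF that] by simp
      then obtain K \<sigma> where "antiderivative_on I \<kappa> K" "\<sigma> \<in> {1, -1}"
        "\<And>s. s \<in> I \<Longrightarrow> v s = \<sigma> * (- cosh (K s))" "\<And>s. s \<in> I \<Longrightarrow> u s = \<sigma> * sinh (K s)"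
        using hyperbolic_rotation_ode[OF conn v _ rel] by blast
      then show ?thesis using w by blast
    qed
    have "timelike_curve I \<alpha> \<or> spacelike_curve I \<alpha>"
      using F by (simp add: frenet_curve_def)
    then consider (time) "timelike_curve I \<alpha>" | (space) "spacelike_curve I \<alpha>" by blast
    then show "\<exists>K. antiderivative_on I \<kappa> K \<and> (?hyp_i \<and> ?sol_i K \<or> ?hyp_ii \<and> ?sol_ii K \<or> ?hyp_iii \<and> ?sol_iii K)"
    proof cases
      case time
      then have "timelike (T s)" if "s \<in> I" for s
        using that vel by (auto simp: timelike_curve_def)
      then have e: "eps (T s) = -1" "eps (N s) = 1" "eps (B s) = 1" if "s \<in> I" for s
        using frenet_eps_timelike[OF F that] that by blast+
      have rel: "(v s)\<^sup>2 - (u s)\<^sup>2 = \<epsilon>" if "s \<in> I" for s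
        using unit[OF that] e[OF that] by simp
      show ?thesis
      proof (cases "\<epsilon> = 1")
        case True
        with sol_ii rel e time X_space show ?thesis by blast
      next
        case False
        then have "\<epsilon> = -1" using \<epsilon>(1) by simp
        then have "(u s)\<^sup>2 - (v s)\<^sup>2 = 1" if "s \<in> I" for s
          using rel[OF that] by simp
        with sol_i e time X_time[OF \<open>\<epsilon> = -1\<close>] show ?thesis by blast
      qed
    next
      case space
      have T1: "eps (T s) = 1" if "s \<in> I" for s
        using space that vel D(2) by (auto simp: spacelike_curve_def intro!: eps_spacelike)
      \<comment> \<open>By continuity \<open>eps (N s)\<close> is constant, so a spacelike
        \<open>\<alpha>\<close> is of one type throughout: type 2 for \<open>\<nu> = 1\<close>, type
        1 for \<open>\<nu> = -1\<close>.\<close>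
      have "continuous_on I (\<lambda>s. eps (N s))"
        by (intro continuous_intros frenet_curve_continuous[OF F])
      then obtain \<nu> :: real where \<nu>: "\<nu> \<in> {1, -1}" "\<And>s. s \<in> I \<Longrightarrow> eps (N s) = \<nu>"
        using connected_unit_sign[OF conn] D(3) by blast
      have B\<nu>: "eps (B s) = - \<nu>" if "s \<in> I" for s
        using frenet_eps_binormal[OF F that] T1[OF that] \<nu>(2)[OF that] by simp
      show ?thesis
      proof (cases "\<nu> = 1")
        case True
        then have type2: "spacelike_type2 I \<alpha> T N B"
          using space T1 \<nu>(2) B\<nu> by (auto simp: spacelike_type2_def timelike_def spacelike_def)
        have rel: "(u s)\<^sup>2 + (v s)\<^sup>2 = \<epsilon>" if "s \<in> I" for s
          using unit[OF that] T1[OF that] \<nu>(2)[OF that] True by simp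
        \<comment> \<open>In type 2 the plane of \<open>T\<close> and \<open>N\<close> is positive
          definite, so \<open>X\<close> cannot be timelike; hence (iii) has no timelike
          counterpart.\<close>
        have "0 \<le> \<epsilon>"
          using rel[OF a] by (metis sum_power2_ge_zero)
        then have \<epsilon>1: "\<epsilon> = 1"
          using \<epsilon>(1) by auto
        have "(u has_real_derivative \<kappa> s * v s) (at s within I)" if "s \<in> I" for s
          using u[OF that] B\<nu>[OF that] True by simp
        then obtain K where "antiderivative_on I \<kappa> K"
          "\<And>s. s \<in> I \<Longrightarrow> u s = - cos (K s)" "\<And>s. s \<in> I \<Longrightarrow> v s = sin (K s)"
          using rotation_ode[OF I(1) frenet_curve_continuous(4)[OF F] _ v] rel \<epsilon>1 by metis
        then show ?thesis using type2 X_space[OF \<epsilon>1] w by blast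
      next
        case False
        then have \<nu>1: "\<nu> = -1" using \<nu>(1) by simp
        then have type1: "spacelike_type1 I \<alpha> T N B"
          using space T1 \<nu>(2) B\<nu> by (auto simp: spacelike_type1_def timelike_def spacelike_def)
        have B1: "eps (B s) = 1" if "s \<in> I" for s
          using B\<nu>[OF that] \<nu>1 by simp
        have rel: "(u s)\<^sup>2 - (v s)\<^sup>2 = \<epsilon>" if "s \<in> I" for s
          using unit[OF that] T1[OF that] \<nu>(2)[OF that] \<nu>1 by simp
        show ?thesis
        proof (cases "\<epsilon> = 1")
          case True
          with sol_i rel B1 type1 X_space show ?thesis by blast
        next
          case False
          then have "\<epsilon> = -1" using \<epsilon>(1) by simp
          then have "(v s)\<^sup>2 - (u s)\<^sup>2 = 1" if "s \<in> I" for s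
            using rel[OF that] by simp
          with sol_ii B1 type1 X_time[OF \<open>\<epsilon> = -1\<close>] show ?thesis by blast
        qed
      qed
    qed
  next
    assume "\<exists>K. antiderivative_on I \<kappa> K \<and> (?hyp_i \<and> ?sol_i K \<or> ?hyp_ii \<and> ?sol_ii K \<or> ?hyp_iii \<and> ?sol_iii K)"
    then obtain K where "antiderivative_on I \<kappa> K"
      and K: "?hyp_i \<and> ?sol_i K \<or> ?hyp_ii \<and> ?sol_ii K \<or> ?hyp_iii \<and> ?sol_iii K"
      by blast
    then have K': "(K has_real_derivative \<kappa> s) (at s within I)" if "s \<in> I" for s
      using that by (simp add: antiderivative_on_def)
    \<comment> \<open>The causal type of \<open>\<alpha>\<close> enters the linear system only
      through \<open>eps (B s)\<close>, which is determined here for the converse.\<close>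
    have B1: "eps (B s) = 1" if "timelike_curve I \<alpha> \<or> spacelike_type1 I \<alpha> T N B" "s \<in> I" for s
      using that(1)
    proof
      assume "timelike_curve I \<alpha>"
      then show ?thesis
        using frenet_eps_timelike(3)[OF F that(2)] vel that(2) by (simp add: timelike_curve_def)
    next
      assume "spacelike_type1 I \<alpha> T N B"
      then show ?thesis
        using that(2) D(4) by (auto simp: spacelike_type1_def intro!: eps_spacelike)
    qed
    have B2: "eps (B s) = -1" if "spacelike_type2 I \<alpha> T N B" "s \<in> I" for s
      using that D(4)[OF that(2)] by (auto simp: spacelike_type2_def timelike_def abs_if split: if_splits)
    show ?M
      unfolding ode_iff
    proof (intro ballI conjI)
      fix s assume s: "s \<in> I"
      show "w s = 0" using K s by blast
      \<comment> \<open>The formulas for \<open>u\<close> and \<open>v\<close> are kept at all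
        points of \<open>I\<close>, not just at \<open>s\<close>, because they have to be
        differentiated within \<open>I\<close>.\<close>
      consider (i) \<sigma> where "eps (B s) = 1"
          "\<And>s. s \<in> I \<Longrightarrow> u s = \<sigma> * (- cosh (K s))" "\<And>s. s \<in> I \<Longrightarrow> v s = \<sigma> * sinh (K s)"
        | (ii) \<sigma> where "eps (B s) = 1"
          "\<And>s. s \<in> I \<Longrightarrow> u s = \<sigma> * sinh (K s)" "\<And>s. s \<in> I \<Longrightarrow> v s = \<sigma> * (- cosh (K s))"
        | (iii) "eps (B s) = -1"
          "\<And>s. s \<in> I \<Longrightarrow> u s = - cos (K s)" "\<And>s. s \<in> I \<Longrightarrow> v s = sin (K s)"
        using K B1[OF _ s] B2[OF _ s] by blast
      then have "(u has_real_derivative - eps (B s) * \<kappa> s * v s) (at s within I) \<and>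
        (v has_real_derivative - \<kappa> s * u s) (at s within I)"
      proof cases
        case i
        show ?thesis
          by (intro conjI has_real_derivative_transform[OF s i(2)] has_real_derivative_transform[OF s i(3)])
             (auto intro!: derivative_eq_intros K'[OF s] simp: i(1) i(2,3)[OF s])
      next
        case ii
        show ?thesis
          by (intro conjI has_real_derivative_transform[OF s ii(2)] has_real_derivative_transform[OF s ii(3)])
             (auto intro!: derivative_eq_intros K'[OF s] simp: ii(1) ii(2,3)[OF s])
      next
        case iii
        show ?thesis
          by (intro conjI has_real_derivative_transform[OF s iii(2)] has_real_derivative_transform[OF s iii(3)])
             (auto intro!: derivative_eq_intros K'[OF s] simp: iii(1) iii(2,3)[OF s])
      qed
      then show "(u has_real_derivative - eps (B s) * \<kappa> s * v s) (at s within I)"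
        "(v has_real_derivative - \<kappa> s * u s) (at s within I)" by blast+
    qed
  qed
qed

end
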